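(* Let $i \geq 5$ be an integer. Suppose that for every $j$ with $5 \leq j \leq i$, the number $N_j$ is the smallest positive integer $\alpha_j$ satisfying $(c_j)^{\alpha_j} \in L_{j-1}$. Then $O(a_i) = O(c_i) = \prod_{j=1}^{i} N_j$.
   Context: Conway's tower of finite fields of characteristic two: $c_{-1} = 1$, $L_{-1} = F_2(c_{-1}) = F_2$ (the field with 2 elements); for $i \geq -1$, $L_{i+1} = L_i(c_{i+1})$, where $c_{i+1}$ satisfies $c_{i+1}^2 + c_{i+1} + \prod_{j=-1}^{i} c_j = 0$. Each $L_{i+1}$ is a quadratic extension of $L_i$, so for $i\ge 0$ the multiplicative group $L_i^* = L_i\setminus\{0\}$ has $2^{2^{i+1}}-1$ elements. Put $a_k = \prod_{j=0}^{k} c_j$ for $k \geq 0$, and let $N_j = 2^{2^j}+1$ ($j \geq 0$) be the Fermat numbers. $O(x)$ denotes the multiplicative order of a nonzero element $x$. *)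

theory Defs
  imports
    "HOL-Algebra.Generated_Fields"
    "HOL-Algebra.Algebraic_Closure_Type"
    "HOL-Library.Z2"
begin

text \<open>
  The tower is taken inside an arbitrary ambient field of characteristic 2, given as a type of
  class \<^class>\<open>field\<close>. The constant \<^const>\<open>ring_of_type_algebra\<close> turns this type into a
  HOL-Algebra ring, so that field adjunction and multiplicative order are the library notions.
\<close>

definition adjoin :: "'a::field set \<Rightarrow> 'a \<Rightarrow> 'a set" where
  "adjoin K x = generate_field ring_of_type_algebra (insert x K)"

definition mult_ord :: "'a::field \<Rightarrow> nat" where
  "mult_ord x = group.ord (mult_of ring_of_type_algebra) x"

text \<open>
  Both \<open>c\<close> and \<open>L\<close> are indexed by the integers from \<open>-1\<close> on; their values at smaller indices are
  unconstrained and never used. Either root of the quadratic equation may be chosen at each step.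
  That every step is a quadratic extension is a consequence and not assumed.
\<close>

locale conway_tower =
  fixes c :: "int \<Rightarrow> 'a::field" and L :: "int \<Rightarrow> 'a set"
  assumes char_2: "CHAR('a) = 2"
    and c_init: "c (-1) = 1"
    and L_init: "L (-1) = {0, 1}"
    and c_step: "i \<ge> -1 \<Longrightarrow> (c (i + 1))\<^sup>2 + c (i + 1) + (\<Prod>j=-1..i. c j) = 0"
    and L_step: "i \<ge> -1 \<Longrightarrow> L (i + 1) = adjoin (L i) (c (i + 1))"

definition conway_prod :: "(int \<Rightarrow> 'a::field) \<Rightarrow> int \<Rightarrow> 'a" where
  "conway_prod c k = (\<Prod>j=0..k. c j)"

definition fermat :: "nat \<Rightarrow> nat" where
  "fermat j = 2 ^ (2 ^ j) + 1"

text \<open>Such towers exist, for instance in an algebraic closure of the field with two elements.\<close>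

lemma conway_tower_exists:
  "\<exists>(c :: int \<Rightarrow> bit alg_closure) L. conway_tower c L"
proof -
  define r :: "bit alg_closure \<Rightarrow> bit alg_closure" where
    "r = (\<lambda>p. SOME x. x\<^sup>2 + x + p = 0)"
  have r: "(r p)\<^sup>2 + r p + p = 0" for p
  proof -
    have "\<exists>x. poly [:p, 1, 1:] x = 0"
      by (rule alg_closed_imp_poly_has_root) simp
    then have "\<exists>x. x\<^sup>2 + x + p = 0"
      by (auto simp: power2_eq_square algebra_simps)
    then show ?thesis
      unfolding r_def by (rule someI_ex)
  qed
  define P where "P = rec_nat 1 (\<lambda>_ p. p * r p)"
  have P: "P 0 = 1" "P (Suc n) = P n * r (P n)" for n
    by (simp_all add: P_def)
  define c where "c = (\<lambda>i::int. if i < 0 then 1 else r (P (nat i)))"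
  define M where "M = rec_nat {0, 1} (\<lambda>n K. adjoin K (c (int n)))"
  define L where "L = (\<lambda>i::int. M (nat (i + 1)))"
  have prod: "(\<Prod>j=-1..int n - 1. c j) = P n" for n
  proof (induction n)
    case 0
    then show ?case by (simp add: c_def P)
  next
    case (Suc n)
    have "{-1..int (Suc n) - 1} = insert (int n) {-1..int n - 1}" by auto
    then show ?case using Suc by (simp add: c_def P)
  qed
  have "conway_tower c L"
  proof
    have of_nat_bit: "(of_nat n :: bit) = of_bool (odd n)" for n
      by (induction n) auto
    have "CHAR(bit) = 2"
      by (rule CHAR_eqI) (auto simp: of_nat_bit split: if_splits)
    then show "CHAR(bit alg_closure) = 2" by simp
    show "c (-1) = 1" by (simp add: c_def)
    show "L (-1) = {0, 1}" by (simp add: L_def M_def)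
  next
    fix i :: int assume "i \<ge> -1"
    then obtain n where i: "i = int n - 1"
      by (metis add.commute add_diff_cancel_left' diff_ge_0_iff_ge diff_minus_eq_add nonneg_int_cases)
    show "(c (i + 1))\<^sup>2 + c (i + 1) + (\<Prod>j=-1..i. c j) = 0"
      using r[of "P n"] unfolding i prod by (simp add: c_def)
    show "L (i + 1) = adjoin (L i) (c (i + 1))"
      by (simp add: i L_def M_def nat_add_distrib)
  qed
  then show ?thesis by blast
qed

end

theory Submission
  imports Defs
begin

text \<open>
  Put \<open>q\<^sub>n = 2 ^ 2 ^ n\<close> and let \<open>P\<^sub>n\<close> be the product of the \<open>c\<^sub>j\<close> with \<open>j < n\<close>, so that \<open>c\<^sub>n\<close> is a
  root of \<open>X\<^sup>2 + X + P\<^sub>n\<close>. The absolute trace of \<open>P\<^sub>n\<close> is 1 for every \<open>n\<close>, because the trace of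
  \<open>P\<^sub>n\<^sub>+\<^sub>1 = P\<^sub>n c\<^sub>n\<close> down one level of the tower is \<open>P\<^sub>n\<close>. Hence the \<open>q\<^sub>n\<close>-Frobenius, which fixes
  \<open>L\<^sub>n\<^sub>-\<^sub>1\<close>, maps \<open>c\<^sub>n\<close> to \<open>c\<^sub>n + 1\<close>; thus \<open>c\<^sub>n \<notin> L\<^sub>n\<^sub>-\<^sub>1\<close>, and the \<open>N\<^sub>n\<close>-th power of \<open>c\<^sub>n\<close> is
  \<open>c\<^sub>n (c\<^sub>n + 1) = P\<^sub>n\<close>. If \<open>N\<^sub>n\<close> is the least exponent that takes \<open>c\<^sub>n\<close> into \<open>L\<^sub>n\<^sub>-\<^sub>1\<close>, which is
  automatic for prime \<open>N\<^sub>n\<close> and so for \<open>n \<le> 4\<close>, then \<open>O(c\<^sub>n) = N\<^sub>n O(P\<^sub>n)\<close>. Moreover, \<open>P\<^sub>n\<^sub>+\<^sub>1\<close> is the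
  \<open>(N\<^sub>n + 1)\<close>-th power of \<open>c\<^sub>n\<close>, and this exponent is coprime to \<open>N\<^sub>1 \<cdots> N\<^sub>n\<close>. The factor \<open>N\<^sub>0 = 3\<close>
  of \<open>O(c\<^sub>1) = 15\<close> is lost in passing to \<open>P\<^sub>2 = c\<^sub>1\<^sup>6\<close>.
\<close>

section \<open>Fermat numbers\<close>

lemma fermat_pos: "fermat n > 0"
  by (simp add: fermat_def)

text \<open>In a nontrivial factorization no factor can lie below \<open>m\<close>, so the product
  would reach \<open>m * m\<close>.\<close>

lemma prime_nat_trial_division:
  assumes "2 \<le> n" "n < m * m" "\<forall>d\<in>set [2..<m]. \<not> d dvd (n::nat)"
  shows "prime n"
proof (rule prime_nat_naiveI[OF assms(1)])
  fix a assume "a dvd n"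
  then obtain b where ab: "n = a * b" ..
  show "a = 1 \<or> a = n"
  proof (rule ccontr)
    assume "\<not> (a = 1 \<or> a = n)"
    then have "a \<noteq> 1" "b \<noteq> 1"
      using ab by auto
    moreover have "a * b \<noteq> 0"
      using ab assms(1) by linarith
    ultimately have "2 \<le> a" "2 \<le> b"
      by (cases a; cases b; auto)+
    then have "m \<le> a" "m \<le> b"
      using ab assms(3) by (metis atLeastLessThan_iff dvd_triv_left dvd_triv_right not_le set_upt)+
    then have "m * m \<le> n"
      unfolding ab by (rule mult_le_mono)
    then show False
      using assms(2) by simp
  qed
qed

lemma prime_65537: "prime (65537::nat)"
proof (rule prime_nat_trial_division)
  \<comment> \<open>The bound 257 is the least number whose square exceeds 65537.\<close>
  show "\<forall>d\<in>set [2..<257]. \<not> d dvd (65537::nat)"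
    by (simp del: set_upt add: upt_rec_numeral)
qed simp_all

lemma prime_fermat:
  assumes "n \<le> 4"
  shows "prime (fermat n)"
proof -
  have "n \<in> {0, 1, 2, 3, 4}"
    using assms by auto
  moreover have "prime (3::nat)" "prime (5::nat)" "prime (17::nat)" "prime (257::nat)"
    by simp_all
  ultimately show ?thesis
    using prime_65537 by (auto simp: fermat_def simp del: prime_nat_numeral_eq)
qed

text \<open>Induction along the factorization of \<open>2 ^ 2 ^ Suc n - 1\<close> as a difference of
  squares.\<close>

lemma fermat_dvd:
  assumes "j < n"
  shows "fermat j dvd 2 ^ 2 ^ n - 1"
  using assms
proof (induction n)
  case (Suc n)
  have "(2::nat) ^ 2 ^ Suc n = 2 ^ 2 ^ n * 2 ^ 2 ^ n"
    by (simp add: mult_2 power_add)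
  then have "(2::nat) ^ 2 ^ Suc n - 1 = (2 ^ 2 ^ n - 1) * fermat n"
    by (simp add: fermat_def algebra_simps)
  with Suc show ?case
    by (cases "j = n") auto
qed simp

lemma fermat_0_dvd: "1 \<le> n \<Longrightarrow> 3 dvd (2::nat) ^ 2 ^ n - 1"
  using fermat_dvd[of 0 n] by (simp add: fermat_def)

text \<open>For \<open>j < n\<close> a common divisor divides 3, because \<open>fermat j\<close>
  divides \<open>2 ^ 2 ^ n - 1\<close>; as 3 divides \<open>2 ^ 2 ^ j - 1\<close>, it then also
  divides 2. The index 0 is excluded because \<open>fermat 0 = 3\<close> divides
  \<open>Suc (fermat n)\<close> for \<open>n \<ge> 1\<close>.\<close>

lemma coprime_Suc_fermat:
  assumes "1 \<le> j" "j \<le> n"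
  shows "coprime (Suc (fermat n)) (fermat j)"
proof (cases "j = n")
  case True
  then show ?thesis by simp
next
  case False
  show ?thesis
  proof (rule coprimeI)
    fix g assume g: "g dvd Suc (fermat n)" "g dvd fermat j"
    have "g dvd 2 ^ 2 ^ n - 1"
      using fermat_dvd[of j n] assms False g(2) dvd_trans by auto
    moreover have "Suc (fermat n) = (2 ^ 2 ^ n - 1) + 3"
      by (simp add: fermat_def)
    ultimately have "g dvd 3"
      using g(1) by (metis dvd_add_right_iff)
    then have "g dvd 2 ^ 2 ^ j - 1"
      using fermat_0_dvd[OF assms(1)] dvd_trans by blast
    moreover have "fermat j = (2 ^ 2 ^ j - 1) + 2"
      by (simp add: fermat_def)
    ultimately have "g dvd 2"
      using g(2) by (metis dvd_add_right_iff)
    with \<open>g dvd 3\<close> have "g dvd 3 - 2"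
      using dvd_diff_nat by blast
    then show "is_unit g" by simp
  qed
qed

section \<open>Multiplicative order\<close>

lemma ring_of_type_algebra_pow:
  "x [^]\<^bsub>ring_of_type_algebra\<^esub> (n::nat) = (x::'a::field) ^ n"
proof -
  interpret field "ring_of_type_algebra :: 'a ring"
    by (rule field_from_type_algebra)
  show ?thesis
    by (induction n) (simp_all add: nat_pow_def ring_of_type_algebra_def mult.commute)
qed

text \<open>All later facts on \<open>mult_ord\<close> go through this equivalence.\<close>

lemma power_eq_1_iff_mult_ord_dvd:
  fixes x :: "'a::field"
  assumes "x \<noteq> 0"
  shows "x ^ n = 1 \<longleftrightarrow> mult_ord x dvd n"
proof -
  \<comment> \<open>Two constants share the name \<open>mult_of\<close>; their agreement carries the
    group structure over to the one in \<open>mult_ord\<close>.\<close>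
  have "Multiplicative_Group.mult_of ring_of_type_algebra = mult_of (ring_of_type_algebra :: 'a ring)"
    by (simp add: Multiplicative_Group.mult_of_def mult_of_def)
  then interpret group "mult_of (ring_of_type_algebra :: 'a ring)"
    using field.field_mult_group[OF field_from_type_algebra] by metis
  have "x \<in> carrier (mult_of ring_of_type_algebra)"
    using assms by (simp add: ring_of_type_algebra_def)
  from pow_eq_id[OF this, of n] show ?thesis
    unfolding mult_ord_def nat_pow_mult_of ring_of_type_algebra_pow
    by (simp add: ring_of_type_algebra_def)
qed

lemma mult_ord_power_coprime:
  fixes x :: "'a::field"
  assumes "x \<noteq> 0" "coprime k (mult_ord x)"
  shows "mult_ord (x ^ k) = mult_ord x"
proof (rule dvd_antisym)
  show "mult_ord (x ^ k) dvd mult_ord x"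
    using assms(1)
    by (simp flip: power_eq_1_iff_mult_ord_dvd)
      (metis dvd_triv_right power_eq_1_iff_mult_ord_dvd power_mult)
  have "mult_ord x dvd k * mult_ord (x ^ k)"
    using assms(1)
    by (simp flip: power_eq_1_iff_mult_ord_dvd add: power_mult)
      (simp add: power_eq_1_iff_mult_ord_dvd)
  then show "mult_ord x dvd mult_ord (x ^ k)"
    using assms(2) by (simp add: coprime_commute coprime_dvd_mult_right_iff)
qed

text \<open>Subtracting the least exponent keeps the power of \<open>x\<close> in \<open>S\<close>,
  so a nonzero remainder of \<open>n\<close> would be a smaller such exponent.\<close>

lemma Least_power_mem_dvd:
  fixes x :: "'a::field"
  assumes "x \<noteq> 0"
    and mult: "\<And>u v. u \<in> S \<Longrightarrow> v \<in> S \<Longrightarrow> u * v \<in> S"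
    and inv: "\<And>u. u \<in> S \<Longrightarrow> u \<noteq> 0 \<Longrightarrow> inverse u \<in> S"
    and p: "p > 0" "x ^ p \<in> S"
    and n: "x ^ n \<in> S"
  shows "(LEAST k. k > 0 \<and> x ^ k \<in> S) dvd n"
proof -
  define a where "a = (LEAST k. k > 0 \<and> x ^ k \<in> S)"
  have a: "a > 0 \<and> x ^ a \<in> S"
    unfolding a_def by (rule LeastI[of _ p]) (use p in simp)
  have "x ^ (n - a * m) \<in> S" if "a * m \<le> n" for m
    using that
  proof (induction m)
    case (Suc m)
    have "x ^ (n - a * m) = x ^ (n - a * Suc m) * x ^ a"
      using Suc.prems by (simp flip: power_add)
    then have "x ^ (n - a * Suc m) = x ^ (n - a * m) * inverse (x ^ a)"
      using \<open>x \<noteq> 0\<close> by (simp add: field_simps)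
    with Suc a \<open>x \<noteq> 0\<close> show ?case
      by (simp add: mult inv)
  qed (use n in simp)
  from this[of "n div a"] have "x ^ (n mod a) \<in> S"
    by (simp add: minus_mult_div_eq_mod)
  moreover have "n mod a < a"
    using a by simp
  ultimately have "n mod a = 0"
    using not_less_Least[of "n mod a" "\<lambda>k. k > 0 \<and> x ^ k \<in> S"] by (simp flip: a_def)
  then show ?thesis
    unfolding a_def by (simp add: mod_eq_0_iff_dvd)
qed

section \<open>The tower\<close>

lemma adjoin_incl: "h \<in> insert x K \<Longrightarrow> h \<in> adjoin K x"
    and adjoin_mult: "u \<in> adjoin K x \<Longrightarrow> v \<in> adjoin K x \<Longrightarrow> u * v \<in> adjoin K x"
    and adjoin_inverse: "u \<in> adjoin K x \<Longrightarrow> u \<noteq> 0 \<Longrightarrow> inverse u \<in> adjoin K x"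
proof -
  interpret field "ring_of_type_algebra :: 'a ring"
    by (rule field_from_type_algebra)
  show "h \<in> insert x K \<Longrightarrow> h \<in> adjoin K x"
    unfolding adjoin_def by (rule generate_field.incl)
  show "u \<in> adjoin K x \<Longrightarrow> v \<in> adjoin K x \<Longrightarrow> u * v \<in> adjoin K x"
    unfolding adjoin_def
    using generate_field.eng_mult[of u ring_of_type_algebra _ v]
    by (simp add: ring_of_type_algebra_def)
  assume u: "u \<in> adjoin K x" "u \<noteq> 0"
  have "inv\<^bsub>ring_of_type_algebra\<^esub> u = inverse u"
    by (rule comm_inv_char) (use u in \<open>simp_all add: ring_of_type_algebra_def\<close>)
  with u show "inverse u \<in> adjoin K x"
    unfolding adjoin_def
    using generate_field.m_inv[of u ring_of_type_algebra]
    by (simp add: ring_of_type_algebra_def)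
qed

text \<open>Minimality of the generated field, to be applied to the fixed field of a Frobenius
  power.\<close>

lemma adjoin_subset:
  fixes x :: "'a::field"
  assumes "insert x K \<subseteq> S" "1 \<in> S"
    and add: "\<And>u v. u \<in> S \<Longrightarrow> v \<in> S \<Longrightarrow> u + v \<in> S"
    and minus: "\<And>u. u \<in> S \<Longrightarrow> - u \<in> S"
    and mult: "\<And>u v. u \<in> S \<Longrightarrow> v \<in> S \<Longrightarrow> u * v \<in> S"
    and inv: "\<And>u. u \<in> S \<Longrightarrow> u \<noteq> 0 \<Longrightarrow> inverse u \<in> S"
  shows "adjoin K x \<subseteq> S"
proof
  interpret field "ring_of_type_algebra :: 'a ring"
    by (rule field_from_type_algebra)
  fix y assume "y \<in> adjoin K x"
  then show "y \<in> S"
    unfolding adjoin_def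
  proof (induction rule: generate_field.induct)
    case one
    then show ?case using assms by (simp add: ring_of_type_algebra_def)
  next
    case (incl h)
    then show ?case using assms by auto
  next
    case (a_inv h)
    have "\<ominus>\<^bsub>ring_of_type_algebra\<^esub> h = - h"
      by (rule sym, rule sum_zero_eq_neg)
        (simp_all add: ring_of_type_algebra_def)
    with a_inv show ?case by (simp add: minus)
  next
    case (m_inv h)
    have "h \<noteq> 0"
      using m_inv by (simp add: ring_of_type_algebra_def)
    then have "inv\<^bsub>ring_of_type_algebra\<^esub> h = inverse h"
      by (intro comm_inv_char) (simp_all add: ring_of_type_algebra_def)
    with m_inv \<open>h \<noteq> 0\<close> show ?case by (simp add: inv)
  next
    case (eng_add u v)
    then show ?case by (simp add: ring_of_type_algebra_def add)
  next
    case (eng_mult u v)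
    then show ?case by (simp add: ring_of_type_algebra_def mult)
  qed
qed

context conway_tower
begin

lemma minus_eq [simp]: "- (x::'a) = x"
  using char_2 by (rule uminus_CHAR_2)

lemma add_self [simp]: "(x::'a) + x = 0"
  using minus_eq[of x] add.right_inverse by metis

lemma frobenius_add: "((x::'a) + y) ^ 2 ^ m = x ^ 2 ^ m + y ^ 2 ^ m"
  using freshmans_dream'[where 'a = 'a and m = "2 ^ m"] char_2 by simp

definition P :: "nat \<Rightarrow> 'a" where
  "P n = (\<Prod>j=-1..int n - 1. c j)"

lemma P_0 [simp]: "P 0 = 1"
  by (simp add: P_def c_init)

lemma P_Suc: "P (Suc n) = P n * c (int n)"
proof -
  have "{-1..int (Suc n) - 1} = insert (int n) {-1..int n - 1}" by auto
  then show ?thesis by (simp add: P_def)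
qed

lemma conway_prod_eq: "conway_prod c (int n) = P (Suc n)"
proof -
  have "{-1..int (Suc n) - 1} = insert (-1) {0..int n}" by auto
  then show ?thesis by (simp add: P_def conway_prod_def c_init)
qed

lemma c_square: "(c (int n))\<^sup>2 = c (int n) + P n"
proof -
  have "(c (int n))\<^sup>2 + (c (int n) + P n) = 0"
    using c_step[of "int n - 1"] by (simp add: P_def add.assoc)
  then show ?thesis
    by (metis add_eq_0_iff minus_eq)
qed

lemma P_nonzero: "P n \<noteq> 0"
  and c_nonzero: "c (int n) \<noteq> 0"
proof -
  have *: "c (int n) \<noteq> 0" if "P n \<noteq> 0" for n
    using c_square[of n] that by auto
  show "P n \<noteq> 0"
    by (induction n) (simp_all add: P_Suc *)
  then show "c (int n) \<noteq> 0" by (rule *)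
qed

lemma L_int: "L (int n) = adjoin (L (int n - 1)) (c (int n))"
  using L_step[of "int n - 1"] by simp

lemma L_mult: "u \<in> L (int n - 1) \<Longrightarrow> v \<in> L (int n - 1) \<Longrightarrow> u * v \<in> L (int n - 1)"
  by (cases n) (auto simp: L_init L_int adjoin_mult)

lemma L_inverse: "u \<in> L (int n - 1) \<Longrightarrow> u \<noteq> 0 \<Longrightarrow> inverse u \<in> L (int n - 1)"
  by (cases n) (auto simp: L_init L_int adjoin_inverse)

lemma P_in_L: "P n \<in> L (int n - 1)"
proof (induction n)
  case 0
  then show ?case by (simp add: L_init)
next
  case (Suc n)
  then show ?case
    by (simp add: L_int P_Suc adjoin_mult adjoin_incl)
qed

section \<open>Traces and the Frobenius action on the tower\<close>

text \<open>On the field with \<open>2 ^ k\<close> elements this is the absolute trace.\<close>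

definition frob_sum :: "nat \<Rightarrow> 'a \<Rightarrow> 'a" where
  "frob_sum k x = (\<Sum>m<k. x ^ 2 ^ m)"

text \<open>Transitivity of the trace in a quadratic extension: the sum splits at \<open>k\<close>,
  and the argument on the right is the relative trace.\<close>

lemma frob_sum_add: "frob_sum (k + k) x = frob_sum k (x + x ^ 2 ^ k)"
proof -
  have "frob_sum (k + k) x = (\<Sum>m<k. x ^ 2 ^ m) + (\<Sum>m<k. x ^ 2 ^ (k + m))"
    unfolding frob_sum_def
    by (simp add: lessThan_atLeast0 sum.atLeastLessThan_concat[of 0 k "k + k", symmetric]
        sum.shift_bounds_nat_ivl[of _ 0 k k, simplified] add.commute)
  then show ?thesis
    by (simp add: frob_sum_def frobenius_add sum.distrib power_add power_mult)
qed

text \<open>Raising \<open>c_square\<close> to the power \<open>2 ^ k\<close> adds the next term of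
  the sum.\<close>

lemma c_frobenius: "c (int n) ^ 2 ^ k = c (int n) + frob_sum k (P n)"
proof (induction k)
  case 0
  then show ?case by (simp add: frob_sum_def)
next
  case (Suc k)
  have "c (int n) ^ 2 ^ Suc k = ((c (int n))\<^sup>2) ^ 2 ^ k"
    by (simp add: power_mult)
  also have "\<dots> = c (int n) ^ 2 ^ k + P n ^ 2 ^ k"
    by (simp add: c_square frobenius_add)
  finally show ?case
    by (simp add: Suc frob_sum_def add.assoc)
qed

lemma P_trace: "frob_sum (2 ^ n) (P n) = 1"
proof -
  \<comment> \<open>The second conjunct strengthens the induction: the Frobenius must fix
    \<open>P n\<close> when it is applied to \<open>P (Suc n) = P n * c (int n)\<close>.\<close>
  have "frob_sum (2 ^ n) (P n) = 1 \<and> P n ^ 2 ^ 2 ^ n = P n"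
  proof (induction n)
    case 0
    then show ?case by (simp add: frob_sum_def)
  next
    case (Suc n)
    let ?c = "c (int n)"
    have c1: "?c ^ 2 ^ 2 ^ n = ?c + 1"
      using Suc c_frobenius[of n "2 ^ n"] by simp
    then have P1: "P (Suc n) ^ 2 ^ 2 ^ n = P (Suc n) + P n"
      using Suc by (simp add: P_Suc power_mult_distrib distrib_left)
    have two: "(2::nat) ^ Suc n = 2 ^ n + 2 ^ n" by simp
    have "P (Suc n) ^ 2 ^ 2 ^ Suc n = (P (Suc n) ^ 2 ^ 2 ^ n) ^ 2 ^ 2 ^ n"
      unfolding two power_add by (simp only: power_mult)
    also have "\<dots> = P (Suc n)"
      using Suc by (simp add: P1 frobenius_add add.assoc)
    \<comment> \<open>The relative trace \<open>P (Suc n) + (P (Suc n) + P n)\<close> collapses to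
      \<open>P n\<close>.\<close>
    finally show ?case
      unfolding two frob_sum_add P1 using Suc by (simp flip: add.assoc)
  qed
  then show ?thesis ..
qed

lemma c_conjugate: "c (int n) ^ 2 ^ 2 ^ n = c (int n) + 1"
  by (simp add: c_frobenius P_trace)

lemma c_power_fermat: "c (int n) ^ fermat n = P n"
proof -
  have "c (int n) ^ fermat n = (c (int n))\<^sup>2 + c (int n)"
    by (simp add: fermat_def c_conjugate distrib_left power2_eq_square)
  also have "\<dots> = P n + (c (int n) + c (int n))"
    unfolding c_square by (simp only: ac_simps)
  finally show ?thesis by simp
qed

text \<open>The fixed points of a Frobenius power form a field. Squaring the Frobenius of the
  previous level fixes the new generator too, since it adds 1 twice.\<close>

lemma L_fixed: "x \<in> L (int n - 1) \<Longrightarrow> x ^ 2 ^ 2 ^ n = x"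
proof (induction n arbitrary: x)
  case 0
  then show ?case by (auto simp: L_init)
next
  case (Suc n)
  have sq: "x ^ 2 ^ 2 ^ Suc n = (x ^ 2 ^ 2 ^ n) ^ 2 ^ 2 ^ n" for x :: 'a
    by (simp add: mult_2 power_add flip: power_mult)
  have "adjoin (L (int n - 1)) (c (int n)) \<subseteq> {x. x ^ 2 ^ 2 ^ Suc n = x}"
  proof (rule adjoin_subset)
    show "insert (c (int n)) (L (int n - 1)) \<subseteq> {x. x ^ 2 ^ 2 ^ Suc n = x}"
      unfolding sq using Suc.IH
      by (auto simp: c_conjugate frobenius_add add.assoc)
  qed (auto simp: frobenius_add power_mult_distrib power_inverse simp del: power_Suc)
  with Suc.prems show ?case by (auto simp: L_int)
qed

lemma c_notin_L: "c (int n) \<notin> L (int n - 1)"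
proof
  assume "c (int n) \<in> L (int n - 1)"
  then have "c (int n) + 1 = c (int n) + 0"
    using L_fixed c_conjugate[of n] by (metis add.right_neutral)
  then show False
    by (metis add_left_cancel zero_neq_one)
qed

section \<open>Least exponents and multiplicative orders in the tower\<close>

lemma Least_c_power_dvd:
  assumes "c (int n) ^ m \<in> L (int n - 1)"
  shows "(LEAST k. k > 0 \<and> c (int n) ^ k \<in> L (int n - 1)) dvd m"
proof (rule Least_power_mem_dvd[where p = "fermat n"])
  show "c (int n) ^ fermat n \<in> L (int n - 1)"
    unfolding c_power_fermat by (rule P_in_L)
qed (fact c_nonzero L_mult L_inverse fermat_pos assms)+

text \<open>The least exponent divides the prime \<open>fermat n\<close> and is not 1 by
  \<open>c_notin_L\<close>.\<close>

lemma Least_c_power_prime: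
  assumes "prime (fermat n)"
  shows "fermat n = (LEAST k. k > 0 \<and> c (int n) ^ k \<in> L (int n - 1))"
    (is "_ = ?a")
proof -
  have "0 < ?a \<and> c (int n) ^ ?a \<in> L (int n - 1)"
    by (rule LeastI[of _ "fermat n"])
      (simp add: c_power_fermat P_in_L fermat_pos)
  then have "?a \<noteq> 1"
    using c_notin_L[of n] by auto
  moreover have "?a dvd fermat n"
    by (rule Least_c_power_dvd) (simp add: c_power_fermat P_in_L)
  ultimately show ?thesis
    using assms by (metis prime_nat_iff)
qed

text \<open>If \<open>c (int n) ^ m = 1\<close>, then minimality forces \<open>fermat n\<close> to
  divide \<open>m\<close>, and the power becomes \<open>P n ^ (m div fermat n)\<close>.\<close>

lemma mult_ord_c:
  assumes "fermat n = (LEAST k. k > 0 \<and> c (int n) ^ k \<in> L (int n - 1))"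
  shows "mult_ord (c (int n)) = mult_ord (P n) * fermat n"
proof -
  have "c (int n) ^ m = 1 \<longleftrightarrow> mult_ord (P n) * fermat n dvd m" for m
  proof (cases "fermat n dvd m")
    case True
    then obtain k where m: "m = fermat n * k" ..
    then have "c (int n) ^ m = P n ^ k"
      by (simp add: power_mult c_power_fermat)
    then show ?thesis
      using fermat_pos[of n]
      by (simp add: m power_eq_1_iff_mult_ord_dvd P_nonzero mult.commute[of "fermat n"])
  next
    case False
    have "1 \<in> L (int n - 1)"
      using P_in_L[of n] P_nonzero[of n] L_mult L_inverse by (metis right_inverse)
    then have "c (int n) ^ m \<noteq> 1"
      using False Least_c_power_dvd[of n m] assms by auto
    with False show ?thesis
      using dvd_mult_right by blast
  qed
  then show ?thesis
    unfolding power_eq_1_iff_mult_ord_dvd[OF c_nonzero] by (meson dvd_antisym dvd_refl)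
qed

lemma P_Suc_eq_power: "P (Suc n) = c (int n) ^ Suc (fermat n)"
  unfolding P_Suc power_Suc c_power_fermat by (rule mult.commute)

text \<open>The exponent 6 and the order 15 of \<open>c 1\<close> share the factor 3, so
  \<open>mult_ord_power_coprime\<close> does not apply and the order is computed directly.\<close>

lemma mult_ord_P_2: "mult_ord (P 2) = fermat 1"
proof -
  have ord: "mult_ord (c (int n)) = mult_ord (P n) * fermat n" if "n \<le> 4" for n
    by (rule mult_ord_c[OF Least_c_power_prime[OF prime_fermat[OF that]]])
  have "mult_ord (P 0) = 1"
    using power_eq_1_iff_mult_ord_dvd[of "P 0" 1] by simp
  then have "mult_ord (P (Suc 0)) = 3"
    using ord[of 0] by (simp add: fermat_def P_Suc)
  then have c1: "mult_ord (c (int 1)) = 15"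
    using ord[of 1] by (simp add: fermat_def)
  have "Suc (fermat 1) = 6"
    by (simp add: fermat_def)
  then have P2: "P 2 = c (int 1) ^ 6"
    using P_Suc_eq_power[of 1] by (metis Suc_1)
  have "P 2 ^ m = 1 \<longleftrightarrow> 5 dvd m" for m
  proof -
    have "P 2 ^ m = 1 \<longleftrightarrow> 15 dvd 6 * m"
      unfolding P2 power_mult[symmetric] power_eq_1_iff_mult_ord_dvd[OF c_nonzero] c1 ..
    also have "\<dots> \<longleftrightarrow> 5 dvd m"
      by presburger
    finally show ?thesis .
  qed
  then have "mult_ord (P 2) = 5"
    unfolding power_eq_1_iff_mult_ord_dvd[OF P_nonzero] by (meson dvd_antisym dvd_refl)
  then show ?thesis
    by (simp add: fermat_def)
qed

lemma mult_ord_P_Suc: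
  assumes "mult_ord (c (int n)) = (\<Prod>j=1..n. fermat j)"
  shows "mult_ord (P (Suc n)) = mult_ord (c (int n))"
  unfolding P_Suc_eq_power
proof (rule mult_ord_power_coprime[OF c_nonzero])
  show "coprime (Suc (fermat n)) (mult_ord (c (int n)))"
    unfolding assms by (rule prod_coprime_right) (simp add: coprime_Suc_fermat)
qed

text \<open>Passing from \<open>P n\<close> to \<open>c (int n)\<close> multiplies the order by
  \<open>fermat n\<close>; passing on to \<open>P (Suc n)\<close> preserves it. The induction starts
  at 2, where \<open>mult_ord_P_2\<close> has removed the factor 3.\<close>

lemma mult_ord_tower:
  assumes least: "\<And>j. 2 \<le> j \<Longrightarrow> j \<le> n \<Longrightarrow>
      fermat j = (LEAST k. k > 0 \<and> c (int j) ^ k \<in> L (int j - 1))"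
    and "2 \<le> n"
  shows "mult_ord (P (Suc n)) = mult_ord (c (int n)) \<and>
    mult_ord (c (int n)) = (\<Prod>j=1..n. fermat j)"
  using assms(2,1)
proof (induction n rule: nat_induct_at_least)
  case base
  have c: "mult_ord (c (int 2)) = (\<Prod>j=1..2. fermat j)"
  proof -
    have "{1..2} = {1, 2::nat}" by auto
    then show ?thesis
      using mult_ord_c[OF base[of 2]] mult_ord_P_2 by simp
  qed
  show ?case
    using mult_ord_P_Suc[OF c] c by blast
next
  case (Suc n)
  have "mult_ord (P (Suc n)) = (\<Prod>j=1..n. fermat j)"
    using Suc.IH Suc.prems by simp
  then have c: "mult_ord (c (int (Suc n))) = (\<Prod>j=1..Suc n. fermat j)"
    using mult_ord_c[OF Suc.prems[of "Suc n"]] Suc.hyps by simp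
  show ?case
    using mult_ord_P_Suc[OF c] c by blast
qed

end

theorem theorem4:
  fixes c :: "int \<Rightarrow> 'a::field" and L :: "int \<Rightarrow> 'a set" and i :: nat
  assumes "conway_tower c L"
    and "i \<ge> 5"
    and "\<And>j::nat. 5 \<le> j \<Longrightarrow> j \<le> i \<Longrightarrow>
           fermat j = (LEAST \<alpha>::nat. \<alpha> > 0 \<and> (c (int j)) ^ \<alpha> \<in> L (int j - 1))"
  shows "mult_ord (conway_prod c (int i)) = mult_ord (c (int i)) \<and>
         mult_ord (c (int i)) = (\<Prod>j=1..i. fermat j)"
proof -
  interpret conway_tower c L by fact
  \<comment> \<open>Primality of \<open>fermat j\<close> supplies the levels up to 4, the hypothesis
    those from 5 on.\<close>
  have "fermat j = (LEAST k. k > 0 \<and> c (int j) ^ k \<in> L (int j - 1))" if "j \<le> i" for j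
    using assms(3)[of j] that Least_c_power_prime[of j, OF prime_fermat]
    by (cases "j \<le> 4") auto
  then show ?thesis
    unfolding conway_prod_eq using mult_ord_tower[of i] assms(2) by simp
qed

end
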